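(* The uniformity measure $I_U$ is $\varepsilon$-split proof.
   Context: For $x,y\in\mathbb{R}^d$, $y$ dominates $x$ if $x_i\le y_i$ for all $i\in[d]$ and $x_j<y_j$ for some $j\in[d]$. A set of alternatives is a finite set $A\subseteq\mathbb{R}^d$ ($d\ge 1$ arbitrary) none of whose elements is dominated by another element of $A$. Let $\|x-y\|=\sum_{i=1}^d|x_i-y_i|$. For a finite nonempty set $S\subseteq\mathbb{R}^d$, $I_U(S)=\min_{x,y\in S,\,x\neq y}\|x-y\|$ ($+\infty$ if $|S|=1$; higher is better). For a finite set $B\subseteq\mathbb{R}^d$ and a positive integer $k$, $\mathcal{S}(I_U,B,k)$ is the set of all $S\subseteq B$ with $|S|=k$ maximizing $I_U(S)$ among the size-$k$ subsets of $B$. A measure $I$ is $\varepsilon$-split proof if for any set of alternatives $A$ and any $k\in\mathbb{N}$ with $1\le k\le|A|$ there exists some $\varepsilon>0$ such that for all $x\in A$ and all $y_\varepsilon,z_\varepsilon\in\mathbb{R}^d$ with $\|x-y_\varepsilon\|<\varepsilon$ and $\|x-z_\varepsilon\|<\varepsilon$ the following holds: if $S_\varepsilon\in\mathcal{S}(I,(A\setminus\{x\})\cup\{y_\varepsilon,z_\varepsilon\},k)$, then (i) $S_\varepsilon\subseteq A$ and $S_\varepsilon\in\mathcal{S}(I,A,k)$, or (ii) $(S_\varepsilon\setminus\{y_\varepsilon,z_\varepsilon\})\cup\{x\}\in\mathcal{S}(I,A,k)$. *)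

theory Defs
  imports "HOL-Analysis.Analysis"
begin

definition dominates :: "real ^ 'd \<Rightarrow> real ^ 'd \<Rightarrow> bool" where
  "dominates y x \<longleftrightarrow> (\<forall>i. x $ i \<le> y $ i) \<and> (\<exists>j. x $ j < y $ j)"

definition alternatives :: "(real ^ 'd) set \<Rightarrow> bool" where
  "alternatives A \<longleftrightarrow> finite A \<and> (\<forall>x\<in>A. \<forall>y\<in>A. \<not> dominates y x)"

(* The library norm on real ^ 'd is the Euclidean one. *)
definition l1_norm :: "real ^ 'd \<Rightarrow> real" where
  "l1_norm x = (\<Sum>i\<in>UNIV. \<bar>x $ i\<bar>)"

(* Only meaningful for finite nonempty S. *)
definition uniformity :: "(real ^ 'd) set \<Rightarrow> ereal" where
  "uniformity S =
     (if card S = 1 then \<infinity>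
      else Min {ereal (l1_norm (x - y)) | x y. x \<in> S \<and> y \<in> S \<and> x \<noteq> y})"

(* The measure is one where higher values are better. *)
definition optimal_subsets ::
  "((real ^ 'd) set \<Rightarrow> ereal) \<Rightarrow> (real ^ 'd) set \<Rightarrow> nat \<Rightarrow> (real ^ 'd) set set" where
  "optimal_subsets I B k =
     {S. S \<subseteq> B \<and> card S = k \<and> (\<forall>T. T \<subseteq> B \<and> card T = k \<longrightarrow> I T \<le> I S)}"

definition eps_split_proof :: "((real ^ 'd) set \<Rightarrow> ereal) \<Rightarrow> bool" where
  "eps_split_proof I \<longleftrightarrow>
     (\<forall>A k. alternatives A \<and> 1 \<le> k \<and> k \<le> card A \<longrightarrow>
        (\<exists>\<epsilon>>0. \<forall>x\<in>A. \<forall>y z.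
           l1_norm (x - y) < \<epsilon> \<and> l1_norm (x - z) < \<epsilon> \<longrightarrow>
           (\<forall>S \<in> optimal_subsets I ((A - {x}) \<union> {y, z}) k.
              (S \<subseteq> A \<and> S \<in> optimal_subsets I A k) \<or>
              (S - {y, z}) \<union> {x} \<in> optimal_subsets I A k)))"

end

(* All values of the uniformity measure on subsets of A lie in the finite set D of distances
   between points of A.  Choose \<epsilon> as a fifth of the minimal gap of D.  Moving points by less
   than \<epsilon> lowers the uniformity by at most 2\<epsilon>.  Hence an optimal set S of the perturbed instance
   does not contain both clones, and moving its clone back to x gives a subset of A whose value
   is at most 4\<epsilon>, thus less than one gap, below that of any competitor. *)

theory Submission imports Defs begin

lemma l1_norm_triangle: "l1_norm (x - z) \<le> l1_norm (x - y) + l1_norm (y - z)"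
  unfolding l1_norm_def sum.distrib[symmetric] by (rule sum_mono) simp

lemma l1_norm_minus_commute: "l1_norm (x - y) = l1_norm (y - x)"
  unfolding l1_norm_def by (simp add: abs_minus_commute)

lemma l1_norm_eq_0_iff [simp]: "l1_norm x = 0 \<longleftrightarrow> x = 0"
  unfolding l1_norm_def by (simp add: sum_nonneg_eq_0_iff vec_eq_iff)

lemma l1_norm_nonneg [simp]: "0 \<le> l1_norm x"
  unfolding l1_norm_def by (simp add: sum_nonneg)

lemma l1_norm_pos_iff [simp]: "0 < l1_norm x \<longleftrightarrow> x \<noteq> 0"
  using l1_norm_nonneg[of x] l1_norm_eq_0_iff[of x] by linarith

lemma l1_norm_zero [simp]: "l1_norm 0 = 0"
  by simp

lemma finite_set_gap:
  fixes D :: "real set"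
  assumes "finite D"
  obtains \<delta> where "\<delta> > 0" "\<And>u v. u \<in> D \<Longrightarrow> v \<in> D \<Longrightarrow> u < v \<Longrightarrow> \<delta> \<le> v - u"
proof
  \<comment> \<open>The added \<open>1\<close> keeps \<open>?G\<close> nonempty when
    \<open>D\<close> has no two distinct elements, so that \<open>Min\<close> is meaningful.\<close>
  let ?G = "insert 1 ((\<lambda>(u, v). v - u) ` {(u, v) \<in> D \<times> D. u < v})"
  have fin: "finite ?G"
    by (intro finite.insertI finite_imageI finite_subset[OF _ finite_cartesian_product[OF assms assms]])
      auto
  show "Min ?G > 0"
    using fin by (subst Min_gr_iff) auto
  show "Min ?G \<le> v - u" if "u \<in> D" "v \<in> D" "u < v" for u v
    using fin that by (intro Min_le) force+
qed

text \<open>Secures the \<open>Min\<close> in \<open>uniformity\<close>: with two points there is a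
  pair to measure, and the singleton default \<infinity> is excluded.\<close>

lemma pair_distances:
  assumes "finite S" "2 \<le> card S"
  shows "finite {ereal (l1_norm (x - y)) | x y. x \<in> S \<and> y \<in> S \<and> x \<noteq> y}" (is "finite ?P")
    and "{ereal (l1_norm (x - y)) | x y. x \<in> S \<and> y \<in> S \<and> x \<noteq> y} \<noteq> {}"
proof -
  have "?P \<subseteq> (\<lambda>(x, y). ereal (l1_norm (x - y))) ` (S \<times> S)"
    by auto
  then show "finite ?P"
    using assms(1) by (meson finite_SigmaI finite_imageI finite_subset)
  have "\<exists>x\<in>S. \<exists>y\<in>S. x \<noteq> y"
    using assms card_le_Suc0_iff_eq[of S] by fastforce
  then show "?P \<noteq> {}"
    by blast
qed

lemma uniformity_ge_iff:
  assumes "finite S" "2 \<le> card S"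
  shows "ereal r \<le> uniformity S \<longleftrightarrow> (\<forall>x\<in>S. \<forall>y\<in>S. x \<noteq> y \<longrightarrow> r \<le> l1_norm (x - y))"
proof -
  have "ereal r \<le> uniformity S \<longleftrightarrow>
      (\<forall>d\<in>{ereal (l1_norm (x - y)) | x y. x \<in> S \<and> y \<in> S \<and> x \<noteq> y}. ereal r \<le> d)"
    using Min_ge_iff[OF pair_distances[OF assms]] assms(2) by (simp add: uniformity_def)
  then show ?thesis
    by (auto 4 4)
qed

lemma uniformity_attained:
  assumes "finite S" "2 \<le> card S"
  obtains x y where "x \<in> S" "y \<in> S" "x \<noteq> y" "uniformity S = ereal (l1_norm (x - y))"
  using Min_in[OF pair_distances[OF assms]] assms(2) unfolding uniformity_def by auto

text \<open>By the triangle inequality through \<open>f a\<close> and \<open>f b\<close>, each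
  distance shrinks by at most \<epsilon> per endpoint. Injectivity keeps the image at two points or
  more. This serves both to push competitors into the perturbed instance and to pull
  \<open>S\<close> back.\<close>

lemma uniformity_image_ge:
  assumes "finite S" "2 \<le> card S" "inj_on f S"
    and "\<And>a. a \<in> S \<Longrightarrow> l1_norm (a - f a) \<le> \<epsilon>"
    and "ereal r \<le> uniformity S"
  shows "ereal (r - 2 * \<epsilon>) \<le> uniformity (f ` S)"
proof -
  have "r - 2 * \<epsilon> \<le> l1_norm (f a - f b)" if "a \<in> S" "b \<in> S" "f a \<noteq> f b" for a b
  proof -
    have "r \<le> l1_norm (a - b)"
      using that assms(5) uniformity_ge_iff[OF assms(1,2)] by auto
    also have "\<dots> \<le> l1_norm (a - f a) + (l1_norm (f a - f b) + l1_norm (f b - b))"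
      using l1_norm_triangle[of a b "f a"] l1_norm_triangle[of "f a" b "f b"] by linarith
    finally show ?thesis
      using assms(4)[OF that(1)] assms(4)[OF that(2)] l1_norm_minus_commute[of b "f b"] by linarith
  qed
  moreover have "2 \<le> card (f ` S)"
    using assms by (simp add: card_image)
  ultimately show ?thesis
    using assms(1) by (subst uniformity_ge_iff) auto
qed

lemma uniformity_split:
  fixes A :: "(real ^ 'd) set"
  assumes A: "finite A" and k: "2 \<le> k" "k \<le> card A"
    and gap: "\<And>a b c d. a \<in> A \<Longrightarrow> b \<in> A \<Longrightarrow> c \<in> A \<Longrightarrow> d \<in> A \<Longrightarrow>
      l1_norm (a - b) < l1_norm (c - d) \<Longrightarrow> 5 * \<epsilon> \<le> l1_norm (c - d) - l1_norm (a - b)"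
    and x: "x \<in> A" and y: "l1_norm (x - y) < \<epsilon>" and z: "l1_norm (x - z) < \<epsilon>"
    and S: "S \<in> optimal_subsets uniformity ((A - {x}) \<union> {y, z}) k"
  shows "(S \<subseteq> A \<and> S \<in> optimal_subsets uniformity A k) \<or>
    (S - {y, z}) \<union> {x} \<in> optimal_subsets uniformity A k"
proof -
  \<comment> \<open>\<open>f\<close> pulls clones back to \<open>x\<close>; \<open>g\<close> pushes
    \<open>x\<close> out to the clone \<open>y\<close>.\<close>
  define f where "f a = (if a \<in> {y, z} then x else a)" for a
  define g where "g a = (if a = x then y else a)" for a
  have \<epsilon>: "\<epsilon> > 0"
    using y l1_norm_nonneg[of "x - y"] by linarith
  \<comment> \<open>The degenerate pair \<open>a\<close>, \<open>a\<close> has distance 0, so the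
    gap also bounds every nonzero distance from below.\<close>
  have far: "5 * \<epsilon> \<le> l1_norm (a - b)" if "a \<in> A" "b \<in> A" "a \<noteq> b" for a b
    using gap[of a a a b] that by simp
  \<comment> \<open>Otherwise \<open>y\<close> would be an alternative other than \<open>x\<close>
    at distance below \<epsilon>, against \<open>far\<close>. This makes \<open>g\<close> injective
    on subsets of \<open>A\<close>.\<close>
  have y_notin: "y \<notin> A - {x}"
    using far[OF x] y \<epsilon> by fastforce
  have S_sub: "S \<subseteq> (A - {x}) \<union> {y, z}" and S_card: "card S = k"
    and S_opt: "\<And>T. T \<subseteq> (A - {x}) \<union> {y, z} \<Longrightarrow> card T = k \<Longrightarrow> uniformity T \<le> uniformity S"
    using S by (auto simp: optimal_subsets_def)
  have S_fin: "finite S"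
    using S_sub A finite_subset by blast
  have transfer: "ereal (r - 2 * \<epsilon>) \<le> uniformity S"
    if T: "T \<subseteq> A" "card T = k" and r: "ereal r \<le> uniformity T" for T r
  proof -
    have inj: "inj_on g T"
      using T y_notin by (auto simp: inj_on_def g_def split: if_splits)
    have "ereal (r - 2 * \<epsilon>) \<le> uniformity (g ` T)"
      using T A k(1) r y \<epsilon> inj finite_subset[OF T(1) A]
      by (intro uniformity_image_ge) (auto simp: g_def)
    also have "\<dots> \<le> uniformity S"
    proof (rule S_opt)
      show "g ` T \<subseteq> (A - {x}) \<union> {y, z}"
        using T by (auto simp: g_def)
      show "card (g ` T) = k"
        using T inj by (simp add: card_image)
    qed
    finally show ?thesis .
  qed
  \<comment> \<open>Any \<open>k\<close>-subset of \<open>A\<close> has value at least 5\<epsilon>,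
    so \<open>S\<close> has at least 3\<epsilon>; distinct clones are less than 2\<epsilon>
    apart.\<close>
  have not_both: "y = z" if "y \<in> S" "z \<in> S"
  proof (rule ccontr)
    assume "y \<noteq> z"
    obtain T where T: "T \<subseteq> A" "card T = k" "finite T"
      using obtain_subset_with_card_n[OF k(2)] by metis
    have "ereal (5 * \<epsilon>) \<le> uniformity T"
      using T k(1) far by (subst uniformity_ge_iff) auto
    then have "ereal (3 * \<epsilon>) \<le> uniformity S"
      using transfer[OF T(1,2), of "5 * \<epsilon>"] by simp
    then have "3 * \<epsilon> \<le> l1_norm (y - z)"
      using that \<open>y \<noteq> z\<close> S_card k(1) S_fin by (simp add: uniformity_ge_iff)
    then show False
      using l1_norm_triangle[of y z x] l1_norm_minus_commute[of y x] y z \<epsilon> by linarith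
  qed
  \<comment> \<open>Points of \<open>S\<close> other than clones lie in \<open>A - {x}\<close>, so
    only \<open>y\<close> and \<open>z\<close> could collide under \<open>f\<close>.\<close>
  have inj: "inj_on f S"
    using S_sub not_both by (auto simp: inj_on_def f_def split: if_splits)
  have fS: "f ` S \<subseteq> A" "card (f ` S) = k" "finite (f ` S)"
  proof -
    show "f ` S \<subseteq> A"
      using S_sub x by (auto simp: f_def)
  qed (simp_all add: card_image inj S_card S_fin)
  have "uniformity T \<le> uniformity (f ` S)" if T: "T \<subseteq> A" "card T = k" for T
  proof -
    \<comment> \<open>Both values are attained as distances between points of \<open>A\<close>,
      which lets \<open>gap\<close> compare them.\<close>
    obtain c d where cd: "c \<in> T" "d \<in> T" "uniformity T = ereal (l1_norm (c - d))"
      using uniformity_attained[of T] T k(1) A finite_subset by metis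
    obtain a b where ab: "a \<in> f ` S" "b \<in> f ` S" "uniformity (f ` S) = ereal (l1_norm (a - b))"
      using uniformity_attained[of "f ` S"] fS k(1) by metis
    have "ereal (l1_norm (c - d) - 2 * \<epsilon>) \<le> uniformity S"
      using transfer[OF T] cd(3) by simp
    then have "ereal (l1_norm (c - d) - 2 * \<epsilon> - 2 * \<epsilon>) \<le> uniformity (f ` S)"
      using S_fin S_card k(1) inj y z \<epsilon>
      by (intro uniformity_image_ge) (auto simp: f_def l1_norm_minus_commute[of _ x])
    then have "l1_norm (c - d) - 4 * \<epsilon> \<le> l1_norm (a - b)"
      using ab(3) by simp
    \<comment> \<open>A strict deficit would be at least 5\<epsilon>, but the two moves together
      cost at most 4\<epsilon>.\<close>
    then have "l1_norm (c - d) \<le> l1_norm (a - b)"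
      using gap[of a b c d] ab cd T(1) fS(1) \<epsilon> by fastforce
    then show ?thesis
      using ab(3) cd(3) by simp
  qed
  then have opt: "f ` S \<in> optimal_subsets uniformity A k"
    using fS by (simp add: optimal_subsets_def)
  show ?thesis
  \<comment> \<open>With a clone in \<open>S\<close>, \<open>f\<close> swaps it for
    \<open>x\<close>, which is the second alternative; without one, \<open>f\<close> fixes
    \<open>S\<close>, which is the first.\<close>
  proof (cases "y \<in> S \<or> z \<in> S")
    case True
    then have "f ` S = (S - {y, z}) \<union> {x}"
      by (auto simp: f_def)
    then show ?thesis
      using opt by simp
  next
    case False
    then have "f ` S = S"
      by (force simp: f_def)
    then show ?thesis
      using opt fS(1) by simp
  qed
qed

text \<open>All singletons share the value \<infinity>, so none beats another.\<close>

lemma optimal_subsets_uniformity_1: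
  "S \<in> optimal_subsets uniformity B 1 \<longleftrightarrow> (\<exists>s\<in>B. S = {s})"
  by (auto simp: optimal_subsets_def uniformity_def card_1_singleton_iff)

theorem proposition15: "eps_split_proof (uniformity :: (real ^ 'd) set \<Rightarrow> ereal)"
  unfolding eps_split_proof_def
proof (intro allI impI)
  fix A :: "(real ^ 'd) set" and k :: nat
  assume "alternatives A \<and> 1 \<le> k \<and> k \<le> card A"
  then have A: "finite A" and k: "1 \<le> k" "k \<le> card A"
    by (auto simp: alternatives_def)
  show "\<exists>\<epsilon>>0. \<forall>x\<in>A. \<forall>y z. l1_norm (x - y) < \<epsilon> \<and> l1_norm (x - z) < \<epsilon> \<longrightarrow>
    (\<forall>S\<in>optimal_subsets uniformity (A - {x} \<union> {y, z}) k.
      S \<subseteq> A \<and> S \<in> optimal_subsets uniformity A k \<or>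
      S - {y, z} \<union> {x} \<in> optimal_subsets uniformity A k)"
  proof (cases "k = 1")
    case True
    show ?thesis
      \<comment> \<open>Any positive \<epsilon> would do: a chosen point of \<open>A\<close> stays
        optimal, and a chosen clone is replaced by \<open>x\<close>.\<close>
      unfolding True by (intro exI[of _ 1]) (auto simp: optimal_subsets_uniformity_1 simp del: One_nat_def)
  next
    case False
    \<comment> \<open>The diagonal of \<open>A \<times> A\<close> is kept, so that 0 is among the
      distances and the gap also separates distinct points.\<close>
    have "finite ((\<lambda>(a, b). l1_norm (a - b)) ` (A \<times> A))"
      using A by simp
    from finite_set_gap[OF this] obtain \<delta> where \<delta>: "\<delta> > 0"
      "\<And>u v. u \<in> (\<lambda>(a, b). l1_norm (a - b)) ` (A \<times> A) \<Longrightarrow>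
        v \<in> (\<lambda>(a, b). l1_norm (a - b)) ` (A \<times> A) \<Longrightarrow> u < v \<Longrightarrow> \<delta> \<le> v - u"
      by blast
    have gap: "5 * (\<delta> / 5) \<le> l1_norm (c - d) - l1_norm (a - b)"
      if "a \<in> A" "b \<in> A" "c \<in> A" "d \<in> A" "l1_norm (a - b) < l1_norm (c - d)" for a b c d
      using \<delta>(2)[of "l1_norm (a - b)" "l1_norm (c - d)"] that by force
    show ?thesis
      using uniformity_split[OF A _ k(2) gap] False k(1) \<delta>(1) by (intro exI[of _ "\<delta> / 5"]) auto
  qed
qed

end
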